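(* On any spectral sector in which the Fisher-type quadratic form $g_{\rm FR}^*$ is uniformly nonzero, the relative symplectic correction to the Gaussian Bures cometric obeys $$\frac{|Q_\Omega(P,P)|}{g_{\rm FR}^*(\Sigma;P,P)}=O\!\left(\frac{\hbar^2}{\nu_{\min}^2}\right)\longrightarrow0\qquad\left(\frac{\nu_{\min}}{\hbar}\to\infty\right),$$ where $\nu_{\min}$ is the smallest symplectic eigenvalue of $\Sigma$. Thus the quantum Bures cometric approaches its covariance Fisher component to leading order.
   Context: $\hbar>0$ and $\Omega=\bigoplus_{k=1}^N\begin{pmatrix}0&1\\-1&0\end{pmatrix}$. $\Sigma$ ranges over $N$-mode quantum covariance matrices, i.e. real symmetric positive definite $2N\times2N$ matrices with $\Sigma+\frac{i\hbar}{2}\Omega\ge0$, in a family whose relevant symplectic eigenvalues satisfy $\nu_k\gg\hbar$. The symplectic eigenvalues $\nu_k$ are defined by $\Sigma=S(\bigoplus_k\nu_k\mathbb 1_2)S^{\mathsf T}$ with $S\Omega S^{\mathsf T}=\Omega$. For symmetric covectors $P$ (real symmetric $2N\times2N$ matrices), the Gaussian Bures cometric is $$g_{\rm B}^*(\Sigma;P,P)=g_{\rm FR}^*(\Sigma;P,P)+Q_\Omega(P,P),$$ with Fisher-type term (covariance Fisher component) $g_{\rm FR}^*(\Sigma;P,P)=8\operatorname{Tr}(P\Sigma P\Sigma)$ and symplectic correction $Q_\Omega(P,P)=2\hbar^2\operatorname{Tr}(P\Omega P\Omega)$. The Fisher-type term is quadratic in $\Sigma$, while the symplectic term does not depend on $\Sigma$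 and carries the factor $\hbar^2$. A spectral sector in which the Fisher-type form is uniformly nonzero is understood as a sector bounded away from the kernel of that form. *)

theory Defs
  imports "HOL-Analysis.Analysis" "HOL-Library.Landau_Symbols"
begin

text \<open>
  The finite type \<open>'n\<close> indexes the modes, so that \<open>N = CARD('n)\<close>.  A row or column index
  \<open>(k, a)\<close> of a phase-space matrix consists of a mode \<open>k\<close> and a position \<open>a :: 2\<close>
  inside the two-dimensional block of that mode.
\<close>

type_synonym 'n phase_mat = "real ^ ('n \<times> 2) ^ ('n \<times> 2)"

definition mode_sum :: "('n::finite \<Rightarrow> real ^ 2 ^ 2) \<Rightarrow> 'n phase_mat" where
  "mode_sum B = (\<chi> p q. if fst p = fst q then B (fst p) $ snd p $ snd q else 0)"

definition Omega :: "('n::finite) phase_mat" where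
  "Omega = mode_sum (\<lambda>k. vector [vector [0, 1], vector [-1, 0]])"

definition positive_definite :: "real ^ 'm ^ ('m::finite) \<Rightarrow> bool" where
  "positive_definite A \<longleftrightarrow> transpose A = A \<and> (\<forall>x. x \<noteq> 0 \<longrightarrow> 0 < x \<bullet> (A *v x))"

definition hermitian_psd :: "complex ^ 'm ^ ('m::finite) \<Rightarrow> bool" where
  "hermitian_psd A \<longleftrightarrow>
     (\<forall>i j. A $ j $ i = cnj (A $ i $ j)) \<and>
     (\<forall>z :: complex ^ 'm. 0 \<le> Re (\<Sum>i\<in>UNIV. \<Sum>j\<in>UNIV. cnj (z $ i) * A $ i $ j * z $ j))"

definition quantum_covariance :: "real \<Rightarrow> ('n::finite) phase_mat \<Rightarrow> bool" where
  "quantum_covariance h \<Sigma> \<longleftrightarrow>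
     positive_definite \<Sigma> \<and>
     hermitian_psd (\<chi> p q. complex_of_real (\<Sigma> $ p $ q)
                            + \<i> * complex_of_real (h / 2 * (Omega :: 'n phase_mat) $ p $ q))"

definition symplectic_diagonalisation ::
    "('n::finite) phase_mat \<Rightarrow> 'n phase_mat \<Rightarrow> ('n \<Rightarrow> real) \<Rightarrow> bool" where
  "symplectic_diagonalisation \<Sigma> S \<nu> \<longleftrightarrow>
     S ** Omega ** transpose S = Omega \<and>
     \<Sigma> = S ** mode_sum (\<lambda>k. \<nu> k *\<^sub>R mat 1) ** transpose S"

text \<open>
  By Williamson's theorem every positive definite \<open>\<Sigma>\<close> has such a diagonalisation, and \<open>\<nu>\<close> is
  unique up to permutation, so the following set is finite and nonempty.
\<close>

definition symplectic_eigenvalues :: "('n::finite) phase_mat \<Rightarrow> real set" where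
  "symplectic_eigenvalues \<Sigma> = {\<nu> k |S \<nu> k. symplectic_diagonalisation \<Sigma> S \<nu>}"

definition nu_min :: "('n::finite) phase_mat \<Rightarrow> real" where
  "nu_min \<Sigma> = Min (symplectic_eigenvalues \<Sigma>)"

definition g_FR :: "('n::finite) phase_mat \<Rightarrow> 'n phase_mat \<Rightarrow> 'n phase_mat \<Rightarrow> real" where
  "g_FR \<Sigma> P R = 8 * trace (P ** \<Sigma> ** R ** \<Sigma>)"

definition Q_Omega :: "real \<Rightarrow> ('n::finite) phase_mat \<Rightarrow> 'n phase_mat \<Rightarrow> real" where
  "Q_Omega h P R = 2 * h\<^sup>2 * trace (P ** Omega ** R ** Omega)"

definition g_Bures ::
    "real \<Rightarrow> ('n::finite) phase_mat \<Rightarrow> 'n phase_mat \<Rightarrow> 'n phase_mat \<Rightarrow> real" where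
  "g_Bures h \<Sigma> P R = g_FR \<Sigma> P R + Q_Omega h P R"

definition fisher_kernel :: "('n::finite) phase_mat \<Rightarrow> 'n phase_mat set" where
  "fisher_kernel \<Sigma> = {K. transpose K = K \<and> g_FR \<Sigma> K K = 0}"

text \<open>
  A sector is a set of admissible triples \<open>(\<hbar>, \<Sigma>, P)\<close>; the value of \<open>\<hbar>\<close> may be the same
  throughout the sector or may vary.
\<close>

definition spectral_sector :: "(real \<times> ('n::finite) phase_mat \<times> 'n phase_mat) set \<Rightarrow> bool" where
  "spectral_sector \<S> \<longleftrightarrow>
     (\<forall>(h, \<Sigma>, P) \<in> \<S>. 0 < h \<and> quantum_covariance h \<Sigma> \<and> transpose P = P)"

text \<open>
  The Fisher-type form is homogeneous in \<open>P\<close>, so the distance of \<open>P\<close> to its kernel is measured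
  relative to the (Frobenius) norm of \<open>P\<close>.  In this way a sector may contain all nonzero
  multiples of its covectors.
\<close>

definition fisher_uniformly_nonzero ::
    "(real \<times> ('n::finite) phase_mat \<times> 'n phase_mat) set \<Rightarrow> bool" where
  "fisher_uniformly_nonzero \<S> \<longleftrightarrow>
     (\<exists>c>0. \<forall>(h, \<Sigma>, P) \<in> \<S>. P \<noteq> 0 \<and> c * norm P \<le> infdist P (fisher_kernel \<Sigma>))"

text \<open>
  Convergence along this filter is uniform over all triples of the sector with large
  \<open>\<nu>\<^sub>m\<^sub>i\<^sub>n / \<hbar>\<close>.
\<close>

definition semiclassical ::
    "(real \<times> ('n::finite) phase_mat \<times> 'n phase_mat) set
      \<Rightarrow> (real \<times> 'n phase_mat \<times> 'n phase_mat) filter" where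
  "semiclassical \<S> = inf (filtercomap (\<lambda>(h, \<Sigma>, P). nu_min \<Sigma> / h) at_top) (principal \<S>)"

end

theory Submission
  imports Defs
begin

text \<open>
  Write \<open>\<Sigma> = S D S\<^sup>T\<close> with \<open>S\<close> symplectic and put \<open>Q = S\<^sup>T P S\<close>.  Since also \<open>\<Omega> = S \<Omega> S\<^sup>T\<close>, cyclicity
  turns the two traces into \<open>Tr(Q D Q D) = \<Sum> \<nu>\<^sub>p \<nu>\<^sub>q Q\<^sub>p\<^sub>q\<^sup>2 \<ge> \<nu>\<^sub>m\<^sub>i\<^sub>n\<^sup>2 \<parallel>Q\<parallel>\<^sup>2\<close> and
  \<open>\<bar>Tr(Q \<Omega> Q \<Omega>)\<bar> \<le> \<parallel>Q\<parallel>\<^sup>2\<close>, so the ratio is at most \<open>\<hbar>\<^sup>2 / (4 \<nu>\<^sub>m\<^sub>i\<^sub>n\<^sup>2)\<close>.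

  The diagonalisation exists because \<open>J = - \<Sigma>\<^sup>-\<^sup>1 \<Omega>\<close> is skew for the inner product
  \<open>\<sigma>(x, y) = x \<bullet> \<Sigma> y\<close>: a \<open>\<sigma>\<close>-unit vector \<open>x\<close> maximising \<open>\<sigma>(J x, J x)\<close> spans together with \<open>J x\<close> a
  \<open>J\<close>-invariant plane, and one continues in its \<open>\<sigma>\<close>-orthogonal complement.  The symplectic
  eigenvalues are unique because \<open>(\<Sigma> \<Omega>)\<^sup>2 S = - S D\<^sup>2\<close> for every diagonalisation.
\<close>

section \<open>Invariant planes and normal form of a skew operator\<close>

text \<open>The operator -J^2 is self-adjoint and positive for \<open>\<sigma>\<close>. The
  maximised expression is its Rayleigh quotient, and the maximum \<open>m * m\<close> is its largest
  eigenvalue on \<open>W\<close>.\<close>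

lemma skew_invariant_pair:
  fixes \<sigma> :: "'a::euclidean_space \<Rightarrow> 'a \<Rightarrow> real" and J :: "'a \<Rightarrow> 'a"
  assumes bil: "bilinear \<sigma>" and sym: "\<And>x y. \<sigma> x y = \<sigma> y x" and pos: "\<And>x. x \<noteq> 0 \<Longrightarrow> 0 < \<sigma> x x"
    and lin: "linear J" and inj: "\<And>x. J x = 0 \<Longrightarrow> x = 0"
    and skew: "\<And>x y. \<sigma> (J x) y = - \<sigma> x (J y)"
    and W: "subspace W" and JW: "\<And>x. x \<in> W \<Longrightarrow> J x \<in> W" and u: "u \<in> W" "u \<noteq> 0"
  obtains x y m where "x \<in> W" "y \<in> W" "0 < m" "\<sigma> x x = 1" "\<sigma> y y = 1"
    "J x = m *\<^sub>R y" "J y = - (m *\<^sub>R x)"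
proof -
  note bs = bilinear_lmul[OF bil] bilinear_rmul[OF bil] bilinear_ladd[OF bil] bilinear_radd[OF bil]
    linear_scale[OF lin]
  have cont: "continuous_on S (\<lambda>x. \<sigma> (g x) (g x))" if "linear g" for S and g :: "'a \<Rightarrow> 'a"
    using that by (intro bilinear_continuous_on_compose[OF _ _ bil] linear_continuous_on linear_conv_bounded_linear[THEN iffD1])
  \<comment> \<open>The quotient to be maximised is invariant under scaling, so the Euclidean unit
    sphere of \<open>W\<close>, known to be compact, can stand in for the
    \<open>\<sigma>\<close>-unit sphere.\<close>
  have c: "compact (W \<inter> sphere 0 1)"
    using closed_subspace[OF W] by (simp add: closed_Int_compact)
  have ne: "W \<inter> sphere 0 1 \<noteq> {}"
    using u subspace_scale[OF W u(1), of "inverse (norm u)"]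
    by (intro ex_in_conv[THEN iffD1] exI[of _ "inverse (norm u) *\<^sub>R u"]) auto
  have nz: "x \<in> W \<inter> sphere 0 1 \<Longrightarrow> \<sigma> x x \<noteq> 0" for x
    using pos[of x] by fastforce
  have "continuous_on (W \<inter> sphere 0 1) (\<lambda>x. \<sigma> (J x) (J x) / \<sigma> x x)"
    using nz cont[OF lin] cont[OF linear_id] by (intro continuous_on_divide) auto
  from continuous_attains_sup[OF c ne this] obtain v where v: "v \<in> W" "norm v = 1"
    and vmax: "\<And>x. x \<in> W \<Longrightarrow> norm x = 1 \<Longrightarrow> \<sigma> (J x) (J x) / \<sigma> x x \<le> \<sigma> (J v) (J v) / \<sigma> v v"
    by auto
  define M where "M = \<sigma> (J v) (J v) / \<sigma> v v"
  have v0: "v \<noteq> 0" using v by auto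
  then have M: "M > 0" unfolding M_def using pos inj by (metis divide_pos_pos)
  have max: "\<sigma> (J z) (J z) \<le> M * \<sigma> z z" if "z \<in> W" for z
  proof (cases "z = 0")
    case True
    then show ?thesis using bs(1)[of 0 0 0] linear_0[OF lin] by (simp add: bilinear_lzero[OF bil])
  next
    case False
    have "\<sigma> (J z) (J z) / \<sigma> z z \<le> M"
      using vmax[OF subspace_scale[OF W that, of "inverse (norm z)"]] False M_def
      by (simp add: bs)
    then show ?thesis using pos[OF False] by (simp add: field_simps)
  qed
  define m where "m = sqrt M"
  have m: "m > 0" "m * m = M" using M by (auto simp: m_def)
  define x where "x = inverse (sqrt (\<sigma> v v)) *\<^sub>R v"
  have xW: "x \<in> W" unfolding x_def by (rule subspace_scale[OF W v(1)])
  have x1: "\<sigma> x x = 1" using pos[OF v0] by (simp add: x_def bs field_simps)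
  have xM: "\<sigma> (J x) (J x) = M" using pos[OF v0] by (simp add: x_def bs M_def field_simps)
  define y where "y = inverse m *\<^sub>R J x"
  have yW: "y \<in> W" unfolding y_def by (rule subspace_scale[OF W JW[OF xW]])
  have y1: "\<sigma> y y = 1" using m xM M by (simp add: y_def bs field_simps)
  have Jx: "J x = m *\<^sub>R y" using m by (simp add: y_def)
  \<comment> \<open>equality case of Cauchy--Schwarz, as \<open>\<sigma> (J y) (J y) \<le> m\<^sup>2\<close> by maximality\<close>
  have "\<sigma> (J y) x = - m" using skew[of y x] y1 Jx by (simp add: bs)
  then have "\<sigma> (J y + m *\<^sub>R x) (J y + m *\<^sub>R x) = \<sigma> (J y) (J y) - M"
    using x1 m sym[of x "J y"] by (simp add: bs algebra_simps)
  also have "\<dots> \<le> 0" using max[OF yW] y1 by simp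
  finally have "J y + m *\<^sub>R x = 0" using pos by force
  then have "J y = - (m *\<^sub>R x)" by (simp add: eq_neg_iff_add_eq_0)
  with that xW yW m x1 y1 Jx show ?thesis by blast
qed

text \<open>Invariant planes are split off one at a time. The square length \<open>\<nu> k\<close>
  is chosen so that \<open>\<sigma> (J (t (k, 1))) (t (k, 2)) = 1\<close>: one basis then
  diagonalises \<open>\<sigma>\<close> and gives the skew form its standard shape.\<close>

lemma skew_normal_form:
  fixes \<sigma> :: "'a::euclidean_space \<Rightarrow> 'a \<Rightarrow> real" and J :: "'a \<Rightarrow> 'a" and K :: "'n set"
  assumes bil: "bilinear \<sigma>" and sym: "\<And>x y. \<sigma> x y = \<sigma> y x" and pos: "\<And>x. x \<noteq> 0 \<Longrightarrow> 0 < \<sigma> x x"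
    and lin: "linear J" and inj: "\<And>x. J x = 0 \<Longrightarrow> x = 0"
    and skew: "\<And>x y. \<sigma> (J x) y = - \<sigma> x (J y)"
    and K: "finite K" "2 * card K \<le> DIM('a)"
  shows "\<exists>(t :: 'n \<times> 2 \<Rightarrow> 'a) \<nu>.
      (\<forall>p q. fst p \<in> K \<longrightarrow> fst q \<in> K \<longrightarrow> \<sigma> (t p) (t q) = (if p = q then \<nu> (fst p) else 0)) \<and>
      (\<forall>k\<in>K. 0 < \<nu> k \<and> \<nu> k *\<^sub>R J (t (k, 1)) = t (k, 2) \<and> \<nu> k *\<^sub>R J (t (k, 2)) = - t (k, 1))"
  using K
proof (induction K rule: finite_induct)
  case empty
  then show ?case by simp
next
  case (insert k K)
  note bs = bilinear_lmul[OF bil] bilinear_rmul[OF bil] bilinear_ladd[OF bil] bilinear_radd[OF bil]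
    bilinear_lneg[OF bil] bilinear_rneg[OF bil] bilinear_lzero[OF bil] bilinear_rzero[OF bil]
    linear_scale[OF lin]
  have "2 * card K \<le> DIM('a)" using insert by simp
  then obtain t :: "'n \<times> 2 \<Rightarrow> 'a" and \<nu> where
    t: "\<And>p q. fst p \<in> K \<Longrightarrow> fst q \<in> K \<Longrightarrow> \<sigma> (t p) (t q) = (if p = q then \<nu> (fst p) else 0)"
    and \<nu>: "\<And>k. k \<in> K \<Longrightarrow> 0 < \<nu> k"
    and J1: "\<And>k. k \<in> K \<Longrightarrow> \<nu> k *\<^sub>R J (t (k, 1)) = t (k, 2)"
    and J2: "\<And>k. k \<in> K \<Longrightarrow> \<nu> k *\<^sub>R J (t (k, 2)) = - t (k, 1)"
    using insert.IH by blast
  \<comment> \<open>The \<open>\<sigma>\<close>-orthogonal complement of the planes found so far. It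
    is \<open>J\<close>-invariant because skewness moves \<open>J\<close> onto
    \<open>t (k, a)\<close>, which \<open>J\<close> sends to a multiple of its partner in the same
    plane.\<close>
  define W where "W = {z. \<forall>p \<in> K \<times> UNIV. \<sigma> (t p) z = 0}"
  have W: "subspace W" unfolding W_def by (auto simp: subspace_def bs)
  have JW: "J z \<in> W" if "z \<in> W" for z
  proof -
    have "\<sigma> (t (k, a)) (J z) = 0" if k: "k \<in> K" for k a
    proof -
      have "\<nu> k * \<sigma> (J (t (k, a))) z = \<sigma> (\<nu> k *\<^sub>R J (t (k, a))) z" by (simp add: bs)
      also have "\<dots> = 0"
        using exhaust_2[of a] J1[OF k] J2[OF k] \<open>z \<in> W\<close> k
        by (auto simp: W_def bilinear_lneg[OF bil])
      finally show ?thesis using skew[of "t (k, a)" z] \<nu>[OF k] by simp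
    qed
    then show ?thesis by (auto simp: W_def)
  qed
  \<comment> \<open>The vector \<open>?a p\<close> represents the functional
    \<open>\<sigma> (t p)\<close>. There are fewer such vectors than dimensions, so some nonzero
    \<open>u\<close> is orthogonal to all of them and hence lies in \<open>W\<close>.\<close>
  let ?a = "\<lambda>p. adjoint (\<sigma> (t p)) 1"
  have a: "\<sigma> (t p) z = ?a p \<bullet> z" for p z
  proof -
    have "linear (\<sigma> (t p))" using bil unfolding bilinear_def by blast
    from adjoint_works[OF this, of z 1] show ?thesis by (simp add: inner_commute)
  qed
  have "dim (?a ` (K \<times> (UNIV :: 2 set))) \<le> card (?a ` (K \<times> (UNIV :: 2 set)))"
    using insert.hyps(1) by (intro dim_le_card') simp
  also have "\<dots> \<le> card (K \<times> (UNIV :: 2 set))"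
    using insert.hyps(1) by (intro card_image_le) simp
  also have "\<dots> < DIM('a)" using insert by (simp add: card_cartesian_product)
  finally obtain u where "u \<noteq> 0"
    and u: "\<And>z. z \<in> span (?a ` (K \<times> (UNIV :: 2 set))) \<Longrightarrow> orthogonal u z"
    using orthogonal_to_subspace_exists by blast
  have "\<sigma> (t p) u = 0" if "p \<in> K \<times> UNIV" for p
    using u[OF span_base, of "?a p"] a[of p u] that by (simp add: orthogonal_def inner_commute)
  then have "u \<in> W" unfolding W_def by blast
  from skew_invariant_pair[OF bil sym pos lin inj skew W JW this \<open>u \<noteq> 0\<close>]
  obtain x y m where xy: "x \<in> W" "y \<in> W" "0 < m" "\<sigma> x x = 1" "\<sigma> y y = 1"
    "J x = m *\<^sub>R y" "J y = - (m *\<^sub>R x)" by blast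
  \<comment> \<open>Symmetry gives \<open>\<sigma> x (J x) = \<sigma> (J x) x\<close> while skewness
    gives the opposite sign, so both vanish.\<close>
  have "m * \<sigma> x y = m * \<sigma> y x" by (simp add: sym)
  moreover have "m * \<sigma> x y = \<sigma> x (J x)" "m * \<sigma> y x = \<sigma> (J x) x" using xy by (auto simp: bs)
  ultimately have xy0: "\<sigma> x y = 0" "\<sigma> y x = 0" using skew[of x x] xy by (auto simp: sym)
  \<comment> \<open>Scaling the \<open>\<sigma>\<close>-unit vectors \<open>x\<close> and
    \<open>y\<close> by \<open>inverse (sqrt m)\<close> makes their square length
    \<open>inverse m\<close>; this new value of \<open>\<nu>'\<close> also cancels the factor
    \<open>m\<close> in \<open>J x = m *\<^sub>R y\<close>.\<close>
  define t' where "t' p = (if fst p = k then inverse (sqrt m) *\<^sub>R (if snd p = 1 then x else y) else t p)" for p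
  define \<nu>' where "\<nu>' = \<nu>(k := inverse m)"
  have t'W: "t' (k, a) \<in> W" for a
    using xy subspace_scale[OF W] by (auto simp: t'_def)
  have tt: "\<sigma> (t' p) (t' q) = (if p = q then \<nu>' (fst p) else 0)"
    if pq: "fst p \<in> insert k K" "fst q \<in> insert k K" for p q
  proof (cases "fst p = k"; cases "fst q = k")
    assume "fst p = k" "fst q = k"
    then show ?thesis
      using xy xy0 exhaust_2[of "snd p"] exhaust_2[of "snd q"]
      by (auto simp: t'_def \<nu>'_def bs prod_eq_iff field_simps)
  next
    assume p: "fst p = k" and q: "fst q \<noteq> k"
    have "t' p \<in> W" using p t'W by (metis prod.collapse)
    then have "\<sigma> (t q) (t' p) = 0" using q pq unfolding W_def by (cases q) auto
    then show ?thesis using p q by (auto simp: t'_def sym)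
  next
    assume q: "fst q = k" and p: "fst p \<noteq> k"
    have "t' q \<in> W" using q t'W by (metis prod.collapse)
    then have "\<sigma> (t p) (t' q) = 0" using p pq unfolding W_def by (cases p) auto
    then show ?thesis using p q by (auto simp: t'_def sym)
  next
    assume "fst q \<noteq> k" "fst p \<noteq> k"
    then show ?thesis using t pq by (auto simp: t'_def \<nu>'_def)
  qed
  have "0 < \<nu>' l \<and> \<nu>' l *\<^sub>R J (t' (l, 1)) = t' (l, 2) \<and> \<nu>' l *\<^sub>R J (t' (l, 2)) = - t' (l, 1)"
    if "l \<in> insert k K" for l
    using that xy \<nu> J1 J2 insert.hyps by (cases "l = k") (auto simp: t'_def \<nu>'_def bs)
  then show ?case using tt by blast
qed

section \<open>Algebra of the symplectic form, mode-diagonal and symplectic matrices\<close>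

lemma Omega_nth:
  "(Omega :: 'n::finite phase_mat) $ p $ q =
    (if fst p = fst q then if snd p = 1 \<and> snd q = 2 then 1
       else if snd p = 2 \<and> snd q = 1 then -1 else 0 else 0)"
  using exhaust_2[of "snd p"] exhaust_2[of "snd q"] by (auto simp: Omega_def mode_sum_def)

lemma transpose_Omega: "transpose Omega = - (Omega :: 'n::finite phase_mat)"
  by (auto simp: vec_eq_iff transpose_def Omega_nth)

lemma Omega_Omega: "Omega ** Omega = - (mat 1 :: 'n::finite phase_mat)"
proof -
  have "(Omega ** Omega) $ p $ q = (- mat 1 :: 'n phase_mat) $ p $ q" for p q
  proof -
    have "(Omega ** Omega) $ p $ q = (\<Sum>k\<in>UNIV. \<Sum>a\<in>UNIV. Omega $ p $ (k, a) * (Omega :: 'n phase_mat) $ (k, a) $ q)"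
      by (simp add: matrix_matrix_mult_def sum.cartesian_product UNIV_Times_UNIV)
    also have "\<dots> = (\<Sum>k\<in>UNIV. if k = fst p then (- mat 1 :: 'n phase_mat) $ p $ q else 0)"
      using exhaust_2[of "snd p"] exhaust_2[of "snd q"]
      by (intro sum.cong) (auto simp: sum_2 Omega_nth mat_def prod_eq_iff)
    finally show ?thesis by simp
  qed
  then show ?thesis by (simp add: vec_eq_iff)
qed


lemma matrix_mul_uminus_left: "(- A) ** B = - (A ** B)" for A :: "'a::ring_1 ^ 'n ^ 'm"
  by (simp add: vec_eq_iff matrix_matrix_mult_def sum_negf)

lemma matrix_mul_uminus_right: "A ** (- B) = - (A ** B)" for A :: "'a::ring_1 ^ 'n ^ 'm"
  by (simp add: vec_eq_iff matrix_matrix_mult_def sum_negf)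

lemma transpose_uminus: "transpose (- A) = - transpose A" for A :: "'a::ring_1 ^ 'n ^ 'm"
  by (simp add: vec_eq_iff transpose_def)

lemmas matrix_uminus = matrix_mul_uminus_left matrix_mul_uminus_right transpose_uminus

lemma Omega_Omega_right: "A ** Omega ** Omega = - A" for A :: "'n::finite phase_mat"
  by (simp add: matrix_mul_assoc[symmetric] Omega_Omega matrix_uminus)

abbreviation mode_diag :: "('n::finite \<Rightarrow> real) \<Rightarrow> 'n phase_mat" where
  "mode_diag \<nu> \<equiv> mode_sum (\<lambda>k. \<nu> k *\<^sub>R mat 1)"

lemma mode_diag_nth: "mode_diag \<nu> $ p $ q = (if p = q then \<nu> (fst p) else 0)"
  by (auto simp: mode_sum_def mat_def prod_eq_iff)

lemma mode_diag_mult: "(mode_diag \<nu> ** A) $ p $ q = \<nu> (fst p) * A $ p $ q"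
  by (simp add: matrix_matrix_mult_def mode_diag_nth mult_delta_left)

lemma mult_mode_diag: "(A ** mode_diag \<nu>) $ p $ q = A $ p $ q * \<nu> (fst q)"
  by (simp add: matrix_matrix_mult_def mode_diag_nth mult_delta_right)

text \<open>\<open>Omega\<close> couples only indices of one mode, and there
  \<open>mode_diag \<nu>\<close> is scalar.\<close>

lemma mode_diag_Omega: "mode_diag \<nu> ** Omega = Omega ** mode_diag \<nu>"
  by (auto simp: vec_eq_iff mode_diag_mult mult_mode_diag Omega_nth)

text \<open>Since the inverse of \<open>Omega\<close> is \<open>- Omega\<close>, multiplying the
  symplectic condition by it on the right exhibits the inverse of \<open>S\<close>.\<close>

lemma symplectic_inverse:
  fixes S :: "'n::finite phase_mat"
  assumes "S ** Omega ** transpose S = Omega"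
  shows "S ** (- (Omega ** transpose S ** Omega)) = mat 1"
    and "- (Omega ** transpose S ** Omega) ** S = mat 1"
proof -
  show *: "S ** (- (Omega ** transpose S ** Omega)) = mat 1"
    using assms by (simp add: matrix_uminus matrix_mul_assoc Omega_Omega)
  then show "- (Omega ** transpose S ** Omega) ** S = mat 1"
    by (rule matrix_left_right_inverse[THEN iffD1])
qed

text \<open>The symplectic group is closed under transposition: multiply the left-inverse identity
  by \<open>Omega\<close> on the left.\<close>

lemma symplectic_transpose:
  fixes S :: "'n::finite phase_mat"
  assumes "S ** Omega ** transpose S = Omega"
  shows "transpose S ** Omega ** S = Omega"
proof -
  have "- (Omega ** (Omega ** transpose S ** Omega) ** S) = Omega ** (- (Omega ** transpose S ** Omega) ** S)"
    by (simp add: matrix_uminus matrix_mul_assoc)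
  also have "\<dots> = Omega" by (simp add: symplectic_inverse(2)[OF assms])
  finally show ?thesis by (simp add: matrix_mul_assoc Omega_Omega matrix_uminus)
qed

section \<open>Williamson's theorem\<close>

text \<open>A congruence is the Gram matrix of the columns of \<open>T\<close>; this translates
  between bases and matrices.\<close>

lemma transpose_mult_mult_nth:
  fixes A T :: "real ^ 'm ^ ('m::finite)"
  shows "(transpose T ** A ** T) $ p $ q = column p T \<bullet> (A *v column q T)"
  unfolding matrix_mul_assoc[symmetric]
  by (simp add: matrix_matrix_mult_def matrix_vector_mult_def transpose_def column_def inner_vec_def)

text \<open>The normal form of \<open>J\<close> yields a matrix \<open>T\<close> whose congruence
  takes \<open>\<Sigma>\<close> to \<open>mode_diag \<nu>\<close> and fixes \<open>Omega\<close>.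
  The inverse transpose of \<open>T\<close> is the required \<open>S\<close>.\<close>

theorem williamson:
  fixes \<Sigma> :: "'n::finite phase_mat"
  assumes pd: "positive_definite \<Sigma>"
  obtains S \<nu> where "symplectic_diagonalisation \<Sigma> S \<nu>" "\<And>k. 0 < \<nu> k"
proof -
  have symm: "transpose \<Sigma> = \<Sigma>" and pos: "\<And>x. x \<noteq> 0 \<Longrightarrow> 0 < x \<bullet> (\<Sigma> *v x)"
    using pd by (auto simp: positive_definite_def)
  have adj: "(A *v x) \<bullet> y = x \<bullet> (transpose A *v y)" for A :: "'n phase_mat" and x y
    by (metis dot_lmul_matrix transpose_matrix_vector transpose_transpose)
  have "\<Sigma> *v x = 0 \<Longrightarrow> x = 0" for x using pos[of x] by force
  then obtain B where B: "B ** \<Sigma> = mat 1" using matrix_left_invertible_ker by blast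
  then have B': "\<Sigma> ** B = mat 1" by (rule matrix_left_right_inverse[THEN iffD1])
  define \<sigma> where "\<sigma> x y = x \<bullet> (\<Sigma> *v y)" for x y
  define J where "J x = - (B *v (Omega *v x))" for x
  have SJ: "\<Sigma> *v J x = - (Omega *v x)" for x
    using B' by (simp add: J_def matrix_vector_mul_assoc matrix_mul_assoc vec.neg)
  have bil: "bilinear \<sigma>"
    unfolding bilinear_def \<sigma>_def
    by (auto intro!: linearI simp: inner_left_distrib inner_right_distrib matrix_vector_right_distrib matrix_vector_mult_scaleR)
  have pos': "x \<noteq> 0 \<Longrightarrow> 0 < \<sigma> x x" for x by (simp add: \<sigma>_def pos)
  have sym: "\<sigma> x y = \<sigma> y x" for x y
    unfolding \<sigma>_def by (metis adj inner_commute symm)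
  have lin: "linear J"
    unfolding J_def by (auto intro!: linearI simp: matrix_vector_right_distrib matrix_vector_mult_scaleR)
  have inj: "x = 0" if "J x = 0" for x
  proof -
    have "Omega *v x = 0" using SJ[of x] that by simp
    then have "(Omega ** Omega) *v x = 0" by (simp add: matrix_vector_mul_assoc[symmetric])
    then have "(Omega ** Omega + mat 1) *v x = x" by (simp add: matrix_vector_mult_add_rdistrib)
    then show ?thesis by (simp add: Omega_Omega)
  qed
  \<comment> \<open>\<open>J\<close> represents the standard symplectic form through
    \<open>\<sigma>\<close>, so the basis found for \<open>J\<close> will be a symplectic
    one.\<close>
  have \<omega>: "\<sigma> (J x) y = x \<bullet> (Omega *v y)" for x y
  proof -
    have "\<sigma> (J x) y = (\<Sigma> *v J x) \<bullet> y" by (simp add: \<sigma>_def adj symm)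
    also have "\<dots> = - ((Omega *v x) \<bullet> y)" by (simp add: SJ)
    also have "\<dots> = - (x \<bullet> ((- Omega) *v y))" by (simp add: adj transpose_Omega)
    also have "(- Omega) *v y = - (Omega *v y)"
      by (simp add: matrix_vector_mult_def vec_eq_iff sum_negf)
    finally show ?thesis by simp
  qed
  have skew: "\<sigma> (J x) y = - \<sigma> x (J y)" for x y
    unfolding \<omega> by (simp add: \<sigma>_def SJ)
  \<comment> \<open>All modes can be used at once, as the dimension of phase space is exactly twice
    their number.\<close>
  have "\<exists>(t :: 'n \<times> 2 \<Rightarrow> _) \<nu>. (\<forall>p q. \<sigma> (t p) (t q) = (if p = q then \<nu> (fst p) else 0)) \<and>
      (\<forall>k. 0 < \<nu> k \<and> \<nu> k *\<^sub>R J (t (k, 1)) = t (k, 2) \<and> \<nu> k *\<^sub>R J (t (k, 2)) = - t (k, 1))"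
    using skew_normal_form[OF bil sym pos' lin inj skew, of "UNIV :: 'n set"]
    by (simp del: split_paired_All split_paired_Ex)
  then obtain t :: "'n \<times> 2 \<Rightarrow> _" and \<nu> where
    t: "\<And>p q. \<sigma> (t p) (t q) = (if p = q then \<nu> (fst p) else 0)"
    and \<nu>: "\<And>k. 0 < \<nu> k"
    and J1: "\<And>k. \<nu> k *\<^sub>R J (t (k, 1)) = t (k, 2)"
    and J2: "\<And>k. \<nu> k *\<^sub>R J (t (k, 2)) = - t (k, 1)"
    by blast
  define T where "T = transpose (\<chi> p. t p)"
  have col: "column p T = t p" for p by (simp add: T_def row_def)
  have TS: "transpose T ** \<Sigma> ** T = mode_diag \<nu>"
    unfolding vec_eq_iff transpose_mult_mult_nth col by (metis \<sigma>_def t mode_diag_nth)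
  have "t p \<bullet> (Omega *v t q) = (Omega :: 'n phase_mat) $ p $ q" for p q
  proof -
    \<comment> \<open>The factor \<open>\<nu> (fst p)\<close> turns \<open>J (t p)\<close> into plus
      or minus the partner of \<open>t p\<close>, and orthogonality then gives the entry of
      \<open>Omega\<close>.\<close>
    have "\<nu> (fst p) * (t p \<bullet> (Omega *v t q)) = \<sigma> (\<nu> (fst p) *\<^sub>R J (t p)) (t q)"
      unfolding \<omega>[symmetric] by (simp add: bilinear_lmul[OF bil])
    also have "\<dots> = \<nu> (fst p) * (Omega :: 'n phase_mat) $ p $ q"
      using exhaust_2[of "snd p"] exhaust_2[of "snd q"] J1[of "fst p"] J2[of "fst p"]
      by (cases p; cases q) (auto simp: t Omega_nth bilinear_lneg[OF bil])
    finally show ?thesis using \<nu>[of "fst p"] by simp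
  qed
  then have TO: "transpose T ** Omega ** T = Omega"
    by (simp add: vec_eq_iff transpose_mult_mult_nth col)
  define R where "R = - (Omega ** transpose T ** Omega)"
  have RT: "R ** T = mat 1"
    using TO by (simp add: R_def matrix_uminus matrix_mul_assoc[symmetric] Omega_Omega)
  then have TR: "T ** R = mat 1" by (rule matrix_left_right_inverse[THEN iffD1])
  then have TR': "transpose R ** transpose T = mat 1" by (metis matrix_transpose_mul transpose_mat)
  have conj: "transpose R ** (transpose T ** A ** T) ** R = A" for A
    by (metis TR TR' matrix_mul_assoc matrix_mul_lid matrix_mul_rid)
  have "symplectic_diagonalisation \<Sigma> (transpose R) \<nu>"
    using conj[of Omega] conj[of \<Sigma>] by (simp add: symplectic_diagonalisation_def TO TS)
  with \<nu> that show ?thesis by blast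
qed

section \<open>Uniqueness and positivity of the symplectic eigenvalues\<close>

text \<open>One application gives
  \<open>\<Sigma> ** Omega ** S = S ** mode_diag \<nu> ** Omega\<close>. In the second the two
  factors \<open>Omega\<close> meet and cancel to -1, so the columns of \<open>S\<close> are real
  eigenvectors.\<close>

lemma symplectic_diagonalisation_square:
  assumes "symplectic_diagonalisation \<Sigma> S \<nu>"
  shows "\<Sigma> ** Omega ** \<Sigma> ** Omega ** S = - (S ** mode_diag \<nu> ** mode_diag \<nu>)"
proof -
  have S: "S ** Omega ** transpose S = Omega" and \<Sigma>: "\<Sigma> = S ** mode_diag \<nu> ** transpose S"
    using assms by (auto simp: symplectic_diagonalisation_def)
  have *: "\<Sigma> ** Omega ** S = S ** mode_diag \<nu> ** Omega"
    by (simp add: \<Sigma> symplectic_transpose[OF S] flip: matrix_mul_assoc)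
       (simp add: symplectic_transpose[OF S] matrix_mul_assoc)
  have "\<Sigma> ** Omega ** \<Sigma> ** Omega ** S = \<Sigma> ** Omega ** (\<Sigma> ** Omega ** S)"
    by (simp add: matrix_mul_assoc)
  also have "\<dots> = \<Sigma> ** Omega ** S ** mode_diag \<nu> ** Omega"
    by (simp add: * matrix_mul_assoc)
  also have "\<dots> = S ** mode_diag \<nu> ** (Omega ** mode_diag \<nu>) ** Omega"
    by (simp add: * matrix_mul_assoc)
  also have "\<dots> = S ** mode_diag \<nu> ** (mode_diag \<nu> ** Omega) ** Omega"
    by (simp only: mode_diag_Omega)
  finally show ?thesis by (simp add: matrix_mul_assoc Omega_Omega_right)
qed

text \<open>Comparing the squares through \<open>?U\<close>, the inverse of \<open>S\<close> times
  \<open>T\<close>, shows that an entry of \<open>?U\<close> at \<open>p\<close>, \<open>q\<close>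
  can be nonzero only if the squares of \<open>\<nu> (fst p)\<close> and
  \<open>\<mu> (fst q)\<close> agree. Being invertible, \<open>?U\<close> has no zero
  column.\<close>

lemma symplectic_diagonalisation_eq:
  fixes \<Sigma> :: "'n::finite phase_mat"
  assumes S: "symplectic_diagonalisation \<Sigma> S \<nu>" and T: "symplectic_diagonalisation \<Sigma> T \<mu>"
  shows "\<exists>l. (\<mu> k)\<^sup>2 = (\<nu> l)\<^sup>2"
proof -
  obtain R where R: "S ** R = mat 1" "R ** S = mat 1"
    using symplectic_inverse S unfolding symplectic_diagonalisation_def by blast
  obtain R' where R': "R' ** T = mat 1"
    using symplectic_inverse T unfolding symplectic_diagonalisation_def by blast
  let ?M = "\<Sigma> ** Omega ** \<Sigma> ** Omega" and ?U = "R ** T"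
  have T_eq: "T = S ** ?U" using R by (simp add: matrix_mul_assoc)
  have "?U ** mode_diag \<mu> ** mode_diag \<mu> = R ** (T ** mode_diag \<mu> ** mode_diag \<mu>)"
    by (simp add: matrix_mul_assoc)
  also have "\<dots> = - (R ** (?M ** T))"
    by (simp add: symplectic_diagonalisation_square[OF T] matrix_uminus)
  also have "?M ** T = ?M ** S ** ?U"
    by (subst T_eq) (simp add: matrix_mul_assoc)
  also have "- (R ** (?M ** S ** ?U)) = R ** S ** mode_diag \<nu> ** mode_diag \<nu> ** ?U"
    by (simp add: symplectic_diagonalisation_square[OF S] matrix_uminus matrix_mul_assoc)
  also have "\<dots> = mode_diag \<nu> ** (mode_diag \<nu> ** ?U)"
    by (simp add: R matrix_mul_assoc)
  finally have eq: "?U ** mode_diag \<mu> ** mode_diag \<mu> = mode_diag \<nu> ** (mode_diag \<nu> ** ?U)" .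
  have "(R' ** S) ** ?U = mat 1"
    using R R' by (metis T_eq matrix_mul_assoc)
  have "\<exists>p. ?U $ p $ (k, 1) \<noteq> 0"
  proof (rule ccontr)
    assume "\<not> ?thesis"
    then have "?U $ p $ (k, 1) = 0" for p by blast
    then have "((R' ** S) ** ?U) $ (k, 1) $ (k, 1) = 0"
      unfolding matrix_matrix_mult_def[of "R' ** S"] by simp
    with \<open>(R' ** S) ** ?U = mat 1\<close> show False by (simp add: mat_def)
  qed
  then obtain p where "?U $ p $ (k, 1) \<noteq> 0" by blast
  moreover have "(?U ** mode_diag \<mu> ** mode_diag \<mu>) $ p $ (k, 1) = (mode_diag \<nu> ** (mode_diag \<nu> ** ?U)) $ p $ (k, 1)"
    by (simp only: eq)
  ultimately have "(\<mu> k)\<^sup>2 = (\<nu> (fst p))\<^sup>2"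
    by (simp add: mult_mode_diag mode_diag_mult power2_eq_square algebra_simps)
  then show ?thesis ..
qed

text \<open>Undoing the congruence shows \<open>\<nu> k\<close> to be the value of the quadratic
  form of \<open>\<Sigma>\<close> at a row of the inverse of \<open>S\<close>, which is
  nonzero.\<close>

lemma symplectic_eigenvalues_pos:
  assumes pd: "positive_definite \<Sigma>" and S: "symplectic_diagonalisation \<Sigma> S \<nu>"
  shows "0 < \<nu> k"
proof -
  have sp: "S ** Omega ** transpose S = Omega" and \<Sigma>: "\<Sigma> = S ** mode_diag \<nu> ** transpose S"
    using S by (auto simp: symplectic_diagonalisation_def)
  obtain R where R: "S ** R = mat 1" "R ** S = mat 1"
    using symplectic_inverse[OF sp] by blast
  have R': "transpose S ** transpose R = mat 1"
    using R(2) by (metis matrix_transpose_mul transpose_mat)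
  have "R ** \<Sigma> ** transpose R = (R ** S) ** mode_diag \<nu> ** (transpose S ** transpose R)"
    by (simp add: \<Sigma> matrix_mul_assoc)
  then have "R ** \<Sigma> ** transpose R = mode_diag \<nu>" by (simp add: R R')
  then have "column (k, 1) (transpose R) \<bullet> (\<Sigma> *v column (k, 1) (transpose R)) = \<nu> k"
    using transpose_mult_mult_nth[of "transpose R" \<Sigma> "(k, 1)" "(k, 1)"] by (simp add: mode_diag_nth)
  moreover have "column (k, 1) (transpose R) \<noteq> 0"
  proof
    assume "column (k, 1) (transpose R) = 0"
    then have "(R ** S) $ (k, 1) $ (k, 1) = 0"
      by (simp add: matrix_matrix_mult_def row_def vec_eq_iff del: split_paired_All)
    then show False by (simp add: R mat_def)
  qed
  ultimately show ?thesis using pd by (auto simp: positive_definite_def)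
qed

text \<open>Makes \<open>nu_min\<close> a genuine minimum, as \<open>Min\<close> is meaningful only
  on finite nonempty sets. All diagonalisations take their values from a single fixed one.\<close>

lemma symplectic_eigenvalues_finite_nonempty:
  fixes \<Sigma> :: "'n::finite phase_mat"
  assumes pd: "positive_definite \<Sigma>"
  shows "finite (symplectic_eigenvalues \<Sigma>)" "symplectic_eigenvalues \<Sigma> \<noteq> {}"
proof -
  obtain S \<nu> where S: "symplectic_diagonalisation \<Sigma> S \<nu>" using williamson[OF pd] by blast
  then show "symplectic_eigenvalues \<Sigma> \<noteq> {}" by (auto simp: symplectic_eigenvalues_def)
  have "symplectic_eigenvalues \<Sigma> \<subseteq> range \<nu>"
  proof
    fix x assume "x \<in> symplectic_eigenvalues \<Sigma>"
    then obtain T \<mu> k where T: "symplectic_diagonalisation \<Sigma> T \<mu>" "x = \<mu> k"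
      by (auto simp: symplectic_eigenvalues_def)
    from symplectic_diagonalisation_eq[OF S T(1)] obtain l where "(\<mu> k)\<^sup>2 = (\<nu> l)\<^sup>2" by blast
    then have "\<mu> k = \<nu> l"
      using symplectic_eigenvalues_pos[OF pd T(1), of k] symplectic_eigenvalues_pos[OF pd S, of l]
      by (simp add: power2_eq_iff)
    then show "x \<in> range \<nu>" by (simp add: T)
  qed
  then show "finite (symplectic_eigenvalues \<Sigma>)" by (rule finite_subset) simp
qed

lemma nu_min_pos:
  assumes pd: "positive_definite \<Sigma>"
  shows "0 < nu_min \<Sigma>"
proof -
  have "nu_min \<Sigma> \<in> symplectic_eigenvalues \<Sigma>"
    unfolding nu_min_def using symplectic_eigenvalues_finite_nonempty[OF pd] by (rule Min_in)
  then show ?thesis using symplectic_eigenvalues_pos[OF pd] by (auto simp: symplectic_eigenvalues_def)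
qed

lemma nu_min_le:
  assumes "positive_definite \<Sigma>" "symplectic_diagonalisation \<Sigma> S \<nu>"
  shows "nu_min \<Sigma> \<le> \<nu> k"
  unfolding nu_min_def using assms
  by (intro Min_le symplectic_eigenvalues_finite_nonempty) (auto simp: symplectic_eigenvalues_def)

section \<open>Comparison of the two trace forms\<close>

lemma trace_mult: "trace (A ** B) = (\<Sum>i\<in>UNIV. \<Sum>j\<in>UNIV. A $ i $ j * B $ j $ i)"
  by (simp add: trace_def matrix_matrix_mult_def)

text \<open>Cauchy-Schwarz for \<open>A\<close> and its transpose, which have equal Frobenius norm;
  it is carried out entrywise by the arithmetic-geometric mean inequality.\<close>

lemma abs_trace_square_le:
  fixes A :: "real ^ 'm ^ ('m::finite)"
  shows "\<bar>trace (A ** A)\<bar> \<le> trace (A ** transpose A)"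
proof -
  have "\<bar>trace (A ** A)\<bar> \<le> (\<Sum>i\<in>UNIV. \<Sum>j\<in>UNIV. \<bar>A $ i $ j * A $ j $ i\<bar>)"
    unfolding trace_mult by (intro order_trans[OF sum_abs] sum_mono sum_abs)
  also have "\<dots> \<le> (\<Sum>i\<in>UNIV. \<Sum>j\<in>UNIV. ((A $ i $ j)\<^sup>2 + (A $ j $ i)\<^sup>2) / 2)"
  proof (intro sum_mono)
    fix i j
    have "0 \<le> (\<bar>A $ i $ j\<bar> - \<bar>A $ j $ i\<bar>)\<^sup>2" by simp
    then show "\<bar>A $ i $ j * A $ j $ i\<bar> \<le> ((A $ i $ j)\<^sup>2 + (A $ j $ i)\<^sup>2) / 2"
      by (simp add: power2_diff abs_mult)
  qed
  also have "\<dots> = (\<Sum>i\<in>UNIV. \<Sum>j\<in>UNIV. (A $ i $ j)\<^sup>2) / 2 + (\<Sum>i\<in>UNIV. \<Sum>j\<in>UNIV. (A $ j $ i)\<^sup>2) / 2"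
    by (simp add: add_divide_distrib sum.distrib sum_divide_distrib)
  also have "(\<Sum>i\<in>UNIV. \<Sum>j\<in>UNIV. (A $ j $ i)\<^sup>2) = (\<Sum>i\<in>UNIV. \<Sum>j\<in>UNIV. (A $ i $ j)\<^sup>2)"
    by (rule sum.swap)
  finally show ?thesis by (simp add: trace_mult transpose_def power2_eq_square)
qed

text \<open>Serves both traces: \<open>D\<close> will be \<open>Omega\<close> for the symplectic
  correction and \<open>mode_diag \<nu>\<close> for the Fisher term.\<close>

lemma trace_congruence:
  fixes P S D :: "real ^ 'm ^ ('m::finite)"
  shows "trace (P ** (S ** D ** transpose S) ** P ** (S ** D ** transpose S)) =
    trace ((transpose S ** P ** S) ** D ** (transpose S ** P ** S) ** D)"
proof -
  have "trace (P ** (S ** D ** transpose S) ** P ** (S ** D ** transpose S)) =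
      trace ((P ** S ** D ** transpose S ** P ** S ** D) ** transpose S)"
    by (simp add: matrix_mul_assoc)
  also have "\<dots> = trace (transpose S ** (P ** S ** D ** transpose S ** P ** S ** D))"
    by (rule trace_mul_sym)
  finally show ?thesis by (simp add: matrix_mul_assoc)
qed

text \<open>The constant 1/4 is the ratio of the prefactors 2 and 8 of the two forms.\<close>

lemma Q_Omega_le:
  fixes \<Sigma> P :: "'n::finite phase_mat"
  assumes pd: "positive_definite \<Sigma>" and P: "transpose P = P"
  shows "\<bar>Q_Omega h P P\<bar> \<le> h\<^sup>2 / (4 * (nu_min \<Sigma>)\<^sup>2) * g_FR \<Sigma> P P"
proof -
  obtain S \<nu> where S: "symplectic_diagonalisation \<Sigma> S \<nu>" using williamson[OF pd] by blast
  have sp: "S ** Omega ** transpose S = Omega" and \<Sigma>: "\<Sigma> = S ** mode_diag \<nu> ** transpose S"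
    using S by (auto simp: symplectic_diagonalisation_def)
  let ?m = "nu_min \<Sigma>"
  have m: "0 < ?m" by (rule nu_min_pos[OF pd])
  define Q where "Q = transpose S ** P ** S"
  have Q: "transpose Q = Q" by (simp add: Q_def matrix_transpose_mul P matrix_mul_assoc)
  have "transpose Q $ p $ q = Q $ q $ p" for p q by (simp add: transpose_def)
  then have Qs: "Q $ q $ p = Q $ p $ q" for p q by (simp only: Q)
  have "\<bar>trace (P ** Omega ** P ** Omega)\<bar> = \<bar>trace ((Q ** Omega) ** (Q ** Omega))\<bar>"
    using trace_congruence[of P S Omega] by (simp add: Q_def sp matrix_mul_assoc)
  also have "\<dots> \<le> trace (Q ** Omega ** transpose (Q ** Omega))"
    by (rule abs_trace_square_le)
  also have "Q ** Omega ** transpose (Q ** Omega) = Q ** Q"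
    by (simp add: matrix_transpose_mul transpose_Omega Q matrix_uminus matrix_mul_assoc Omega_Omega_right)
  finally have "?m\<^sup>2 * \<bar>trace (P ** Omega ** P ** Omega)\<bar> \<le> ?m\<^sup>2 * trace (Q ** Q)"
    by (simp add: mult_left_mono)
  also have "\<dots> \<le> trace ((Q ** mode_diag \<nu>) ** (Q ** mode_diag \<nu>))"
  proof -
    \<comment> \<open>Symmetry of \<open>Q\<close> makes each product a square, so the weights can
      be compared term by term.\<close>
    have "?m\<^sup>2 * (Q $ p $ q * Q $ q $ p) \<le> (Q $ p $ q * \<nu> (fst q)) * (Q $ q $ p * \<nu> (fst p))" for p q
    proof -
      have "?m * ?m * (Q $ p $ q)\<^sup>2 \<le> \<nu> (fst q) * \<nu> (fst p) * (Q $ p $ q)\<^sup>2"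
        using m nu_min_le[OF pd S] symplectic_eigenvalues_pos[OF pd S]
        by (intro mult_right_mono mult_mono) (auto intro: less_imp_le)
      then show ?thesis using Qs[of p q] by (simp add: power2_eq_square mult_ac)
    qed
    then show ?thesis
      by (simp add: trace_mult mult_mode_diag sum_distrib_left sum_mono)
  qed
  also have "\<dots> = trace (P ** \<Sigma> ** P ** \<Sigma>)"
    using trace_congruence[of P S "mode_diag \<nu>"] by (simp add: Q_def \<Sigma> matrix_mul_assoc)
  finally have "\<bar>trace (P ** Omega ** P ** Omega)\<bar> \<le> trace (P ** \<Sigma> ** P ** \<Sigma>) / ?m\<^sup>2"
    using m by (simp add: field_simps)
  then have "2 * h\<^sup>2 * \<bar>trace (P ** Omega ** P ** Omega)\<bar> \<le> 2 * h\<^sup>2 * (trace (P ** \<Sigma> ** P ** \<Sigma>) / ?m\<^sup>2)"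
    by (intro mult_left_mono) auto
  then show ?thesis by (simp add: Q_Omega_def g_FR_def abs_mult)
qed

section \<open>Semiclassical asymptotics\<close>

theorem proposition13:
  fixes \<S> :: "(real \<times> ('n::finite) phase_mat \<times> 'n phase_mat) set"
  assumes "spectral_sector \<S>"
    and "fisher_uniformly_nonzero \<S>"
  shows "(\<lambda>(h, \<Sigma>, P). \<bar>Q_Omega h P P\<bar> / g_FR \<Sigma> P P)
           \<in> O[principal \<S>](\<lambda>(h, \<Sigma>, P). h\<^sup>2 / (nu_min \<Sigma>)\<^sup>2)
       \<and> ((\<lambda>(h, \<Sigma>, P). \<bar>Q_Omega h P P\<bar> / g_FR \<Sigma> P P) \<longlongrightarrow> 0) (semiclassical \<S>)
       \<and> (\<lambda>(h, \<Sigma>, P). g_Bures h \<Sigma> P P) \<sim>[semiclassical \<S>] (\<lambda>(h, \<Sigma>, P). g_FR \<Sigma> P P)"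
proof (intro conjI)
  let ?r = "\<lambda>(h, \<Sigma>, P). \<bar>Q_Omega h P P\<bar> / g_FR \<Sigma> P (P :: 'n phase_mat)"
  let ?b = "\<lambda>(h, \<Sigma> :: 'n phase_mat, P :: 'n phase_mat). h\<^sup>2 / (nu_min \<Sigma>)\<^sup>2"
  let ?g = "\<lambda>(h :: real, \<Sigma>, P). g_FR \<Sigma> P (P :: 'n phase_mat)"
  let ?Q = "\<lambda>(h, \<Sigma> :: 'n phase_mat, P). Q_Omega h P (P :: 'n phase_mat)"
  have pos: "0 < h / nu_min \<Sigma>" and Q: "\<bar>Q_Omega h P P\<bar> \<le> h\<^sup>2 / (4 * (nu_min \<Sigma>)\<^sup>2) * g_FR \<Sigma> P P"
    if "(h, \<Sigma>, P) \<in> \<S>" for h \<Sigma> P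
    using assms(1) that nu_min_pos[of \<Sigma>] Q_Omega_le[of \<Sigma> P h]
    by (auto simp: spectral_sector_def quantum_covariance_def)
  have Qg: "\<bar>?Q x\<bar> \<le> ?b x / 4 * ?g x" if "x \<in> \<S>" for x
    using that Q[of "fst x" "fst (snd x)" "snd (snd x)"] by (cases x) (simp add: mult_ac)
  have b: "0 < ?b x" if "x \<in> \<S>" for x
    using that pos[of "fst x" "fst (snd x)" "snd (snd x)"]
    by (cases x) (auto simp: zero_less_divide_iff)
  \<comment> \<open>Nonnegativity of the Fisher form is read off from the estimate
    \<open>Qg\<close>, whose left side is nonnegative and whose factor \<open>?b x / 4\<close> is
    positive.\<close>
  have g: "0 \<le> ?g x" if "x \<in> \<S>" for x
  proof (rule ccontr)
    assume "\<not> ?thesis"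
    then have "?b x / 4 * ?g x < 0" using b[OF that] by (intro mult_pos_neg) simp_all
    with Qg[OF that] show False by linarith
  qed
  have r: "0 \<le> ?r x \<and> ?r x \<le> ?b x / 4" if "x \<in> \<S>" for x
  proof (cases "?g x = 0")
    \<comment> \<open>Here the quotient is 0 by the convention for division by zero.\<close>
    case True
    then show ?thesis using b[OF that] by (cases x) auto
  next
    case False
    then show ?thesis using g[OF that] Qg[OF that] by (cases x) (auto simp: field_simps)
  qed
  show "?r \<in> O[principal \<S>](?b)"
  proof (rule bigoI[where c = "1/4"])
    show "\<forall>\<^sub>F x in principal \<S>. norm (?r x) \<le> 1/4 * norm (?b x)"
      unfolding eventually_principal
    proof
      fix x assume "x \<in> \<S>"
      from r[OF this] b[OF this] show "norm (?r x) \<le> 1/4 * norm (?b x)" by simp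
    qed
  qed
  have S: "\<forall>\<^sub>F x in semiclassical \<S>. x \<in> \<S>"
    unfolding semiclassical_def by (simp add: eventually_inf_principal)
  have "filterlim (\<lambda>(h, \<Sigma>, P). nu_min \<Sigma> / h) at_top (semiclassical \<S>)"
    unfolding semiclassical_def by (rule filterlim_mono[OF filterlim_filtercomap]) auto
  \<comment> \<open>The squared inverse of \<open>nu_min \<Sigma> / h\<close> is exactly
    \<open>?b\<close>.\<close>
  from tendsto_power[OF tendsto_inverse_0_at_top[OF this], of 2]
  have b0: "(?b \<longlongrightarrow> 0) (semiclassical \<S>)"
    by (simp add: case_prod_unfold power_divide)
  show "(?r \<longlongrightarrow> 0) (semiclassical \<S>)"
  proof (rule tendsto_sandwich[where f = "\<lambda>_. 0" and h = "\<lambda>x. ?b x / 4"])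
    show "((\<lambda>x. ?b x / 4) \<longlongrightarrow> 0) (semiclassical \<S>)"
      using tendsto_divide[OF b0 tendsto_const[of 4]] by simp
    show "\<forall>\<^sub>F x in semiclassical \<S>. 0 \<le> ?r x"
      using S by eventually_elim (use r in blast)
    show "\<forall>\<^sub>F x in semiclassical \<S>. ?r x \<le> ?b x / 4"
      using S by eventually_elim (use r in blast)
  qed simp
  \<comment> \<open>The two cometrics differ by \<open>?Q\<close>, so this is the asymptotic
    equivalence; it follows from \<open>Qg\<close> because \<open>?b\<close> eventually drops below
    any \<open>c\<close>.\<close>
  have "?Q \<in> o[semiclassical \<S>](?g)"
  proof (rule landau_o.smallI)
    fix c :: real assume "c > 0"
    then have "\<forall>\<^sub>F x in semiclassical \<S>. ?b x < c"
      by (rule order_tendstoD(2)[OF b0])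
    then show "\<forall>\<^sub>F x in semiclassical \<S>. norm (?Q x) \<le> c * norm (?g x)"
      using S
    proof eventually_elim
      case (elim x)
      have "\<bar>?Q x\<bar> \<le> ?b x / 4 * ?g x" by (rule Qg[OF elim(2)])
      also have "\<dots> \<le> c * ?g x"
        using elim b[OF elim(2)] g[OF elim(2)] by (intro mult_right_mono) auto
      finally show ?case using g[OF elim(2)] by simp
    qed
  qed
  then show "(\<lambda>(h, \<Sigma>, P). g_Bures h \<Sigma> P P) \<sim>[semiclassical \<S>] ?g"
    unfolding asymp_equiv_altdef by (simp add: case_prod_unfold g_Bures_def)
qed

end
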